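(* Let $G=(V,E,\mu,\omega)$ be a locally finite connected weighted graph with $\mu_0:=\inf_{x\in V}\mu(x)>0$, $M_d:=\sup_{x\in V}\deg(x)<\infty$ and $D_\mu:=\sup_{x\in V}\frac{1}{\mu(x)}\sum_{y\sim x}\omega_{xy}<\infty$. Let $\Omega$ be an unbounded subset of $V$ with $\Omega^\circ\neq\emptyset$. If $h\in L^2(\Omega^\circ)$, then for any $p\ge 1$ there exists a solution $u:V\times[0,\infty)\to\mathbb{R}$ of $$\begin{cases}\partial_t u+|u|^{p-1}u=\Delta u, & (x,t)\in\Omega^\circ\times[0,\infty),\\ u(x,0)=h(x), & x\in\Omega^\circ,\\ u(x,t)=0, & (x,t)\in (V\setminus\Omega^\circ)\times[0,\infty).\end{cases}$$
   Context: A locally finite connected weighted graph $G=(V,E,\mu,\omega)$ (without isolated points) consists of a connected graph $(V,E)$ in which every vertex $x$ has at least one and only finitely many neighbours ($x\sim y$ means $xy\in E$; $\deg(x)=\#\{y\in V:y\sim x\}$), a vertex measure $\mu:V\to(0,\infty)$ and an edge weight $\omega:E\to(0,\infty)$ with $\omega_{xy}=\omega_{yx}>0$. Boundedness of subsets of $V$ refers to the graph distance. For nonempty $\Omega\subseteq V$, $\partial\Omega:=\{x\in\Omega:\text{ there is } y\in V\setminus\Omega \text{ with } y\sim x\}$ and $\Omega^\circ:=\Omega\setminus\partial\Omega$. The $\mu$-Laplacian of $v:V\to\mathbb{R}$ is $\Delta v(x)=\frac{1}{\mu(x)}\sum_{y\sim x}\omega_{xy}(v(y)-v(x))$; it acts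 on $u(x,t)$ in the variable $x$. $h:\Omega^\circ\to\mathbb{R}$ belongs to $L^2(\Omega^\circ)$ if $\sum_{x\in\Omega^\circ}\mu(x)|h(x)|^2<\infty$. A solution of the problem is a function $u:V\times[0,\infty)\to\mathbb{R}$ that is continuously differentiable with respect to $t$ and satisfies all three lines of the problem. *)

theory Defs
  imports "HOL-Analysis.Analysis"
begin

text \<open>
  The edge set is a symmetric relation: \<open>(x, y) \<in> E\<close> means \<open>x \<sim> y\<close>, so the neighbours of \<open>x\<close> are
  \<open>E `` {x}\<close>. Loops are not excluded; they do not contribute to the Laplacian.
  The functions \<open>\<mu>\<close>, \<open>\<omega>\<close>, \<open>h\<close>, \<open>u\<close> are total in HOL, but only their values on \<open>V\<close>, \<open>E\<close>,
  the interior of \<open>\<Omega>\<close>, and \<open>V \<times> {0..}\<close>, respectively, are ever constrained.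
\<close>

locale weighted_graph =
  fixes V :: "'a set" and E :: "('a \<times> 'a) set"
    and \<mu> :: "'a \<Rightarrow> real" and \<omega> :: "'a \<Rightarrow> 'a \<Rightarrow> real"
  assumes edges_in_V: "E \<subseteq> V \<times> V"
    and edges_sym: "sym E"
    and connected: "\<And>x y. x \<in> V \<Longrightarrow> y \<in> V \<Longrightarrow> (x, y) \<in> E\<^sup>*"
    and locally_finite: "\<And>x. x \<in> V \<Longrightarrow> finite (E `` {x})"
    and no_isolated: "\<And>x. x \<in> V \<Longrightarrow> E `` {x} \<noteq> {}"
    and vertex_measure_pos: "\<And>x. x \<in> V \<Longrightarrow> \<mu> x > 0"
    and edge_weight_pos: "\<And>x y. (x, y) \<in> E \<Longrightarrow> \<omega> x y > 0"
    and edge_weight_sym: "\<And>x y. (x, y) \<in> E \<Longrightarrow> \<omega> x y = \<omega> y x"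

definition deg :: "('a \<times> 'a) set \<Rightarrow> 'a \<Rightarrow> nat" where
  "deg E x = card (E `` {x})"

text \<open>\<open>E ^^ n\<close> relates exactly the pairs of vertices joined by a walk with \<open>n\<close> edges.\<close>

definition graph_dist :: "('a \<times> 'a) set \<Rightarrow> 'a \<Rightarrow> 'a \<Rightarrow> nat" where
  "graph_dist E x y = (LEAST n. (x, y) \<in> E ^^ n)"

definition graph_bounded :: "('a \<times> 'a) set \<Rightarrow> 'a set \<Rightarrow> bool" where
  "graph_bounded E \<Omega> \<longleftrightarrow> (\<exists>R. \<forall>x\<in>\<Omega>. \<forall>y\<in>\<Omega>. graph_dist E x y \<le> R)"

definition vertex_boundary :: "'a set \<Rightarrow> ('a \<times> 'a) set \<Rightarrow> 'a set \<Rightarrow> 'a set" where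
  "vertex_boundary V E \<Omega> = {x \<in> \<Omega>. \<exists>y \<in> V - \<Omega>. (x, y) \<in> E}"

definition vertex_interior :: "'a set \<Rightarrow> ('a \<times> 'a) set \<Rightarrow> 'a set \<Rightarrow> 'a set" where
  "vertex_interior V E \<Omega> = \<Omega> - vertex_boundary V E \<Omega>"

definition laplacian ::
    "('a \<times> 'a) set \<Rightarrow> ('a \<Rightarrow> real) \<Rightarrow> ('a \<Rightarrow> 'a \<Rightarrow> real) \<Rightarrow> ('a \<Rightarrow> real) \<Rightarrow> 'a \<Rightarrow> real" where
  "laplacian E \<mu> \<omega> v x = (1 / \<mu> x) * (\<Sum>y \<in> E `` {x}. \<omega> x y * (v y - v x))"

definition in_L2 :: "('a \<Rightarrow> real) \<Rightarrow> 'a set \<Rightarrow> ('a \<Rightarrow> real) \<Rightarrow> bool" where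
  "in_L2 \<mu> A h \<longleftrightarrow> (\<lambda>x. \<mu> x * \<bar>h x\<bar>\<^sup>2) summable_on A"

text \<open>The time derivative on \<open>[0, \<infinity>)\<close>; at \<open>t = 0\<close> it is the one-sided derivative.\<close>

definition time_deriv :: "('a \<Rightarrow> real \<Rightarrow> real) \<Rightarrow> 'a \<Rightarrow> real \<Rightarrow> real" where
  "time_deriv u x t = vector_derivative (u x) (at t within {0..})"

definition time_C1 :: "'a set \<Rightarrow> ('a \<Rightarrow> real \<Rightarrow> real) \<Rightarrow> bool" where
  "time_C1 V u \<longleftrightarrow>
     (\<forall>x\<in>V. u x differentiable_on {0..} \<and> continuous_on {0..} (time_deriv u x))"

text \<open>
  For \<open>p = 1\<close> and \<open>u x t = 0\<close> the convention \<open>0 powr 0 = 0\<close> is harmless, because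
  of the factor \<open>u x t\<close>.
\<close>

definition is_solution ::
    "'a set \<Rightarrow> ('a \<times> 'a) set \<Rightarrow> ('a \<Rightarrow> real) \<Rightarrow> ('a \<Rightarrow> 'a \<Rightarrow> real) \<Rightarrow> 'a set \<Rightarrow> real
      \<Rightarrow> ('a \<Rightarrow> real) \<Rightarrow> ('a \<Rightarrow> real \<Rightarrow> real) \<Rightarrow> bool" where
  "is_solution V E \<mu> \<omega> \<Omega> p h u \<longleftrightarrow>
     time_C1 V u \<and>
     (\<forall>x \<in> vertex_interior V E \<Omega>. \<forall>t\<ge>0.
        time_deriv u x t + \<bar>u x t\<bar> powr (p - 1) * u x t = laplacian E \<mu> \<omega> (\<lambda>y. u y t) x) \<and>
     (\<forall>x \<in> vertex_interior V E \<Omega>. u x 0 = h x) \<and>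
     (\<forall>x \<in> V - vertex_interior V E \<Omega>. \<forall>t\<ge>0. u x t = 0)"

end

theory Submission
  imports Defs
begin

text \<open>
  Since \<open>\<mu>\<close> is bounded below, \<open>h\<close> is bounded, say \<open>\<bar>h\<bar> \<le> M\<close>. With \<open>D\<close> a bound for the weighted
  degrees and \<open>c\<close> a Lipschitz constant of \<open>r \<mapsto> \<bar>r\<bar>\<^sup>p\<^sup>-\<^sup>1 r\<close> on \<open>[-M, M]\<close>, put \<open>K = D + c\<close>.
  On functions with values in \<open>[-M, M]\<close> the right-hand side \<open>N v = \<Delta> v - \<bar>v\<bar>\<^sup>p\<^sup>-\<^sup>1 v + K v\<close> is then
  monotone in \<open>v\<close> and bounded by \<open>K M\<close>, so the integral operator that belongs to
  \<open>\<partial>\<^sub>t u + K u = N u\<close> is monotone and preserves the bound \<open>M\<close>. Iterating it from the constant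
  \<open>-M\<close> gives an increasing sequence whose pointwise limit is a fixed point by dominated
  convergence. As \<open>N\<close> involves only finitely many vertices at a time, pointwise convergence suffices.
\<close>

section \<open>Half-line continuity and estimates for the power nonlinearity\<close>

lemma continuous_on_atLeast:
  fixes f :: "real \<Rightarrow> 'b::topological_space"
  assumes "\<And>b. continuous_on {a..b} f"
  shows "continuous_on {a..} f"
  unfolding continuous_on_eq_continuous_within
proof
  fix t assume t: "t \<in> {a..}"
  have "at t within {a..} = at t within {a..t + 1}"
    by (rule at_within_nhd[of t "{..<t + 1}"]) auto
  moreover have "continuous (at t within {a..t + 1}) f"
    using assms[of "t + 1"] t by (simp add: continuous_on_eq_continuous_within)
  ultimately show "continuous (at t within {a..}) f"
    by simp
qed

text \<open>On [0, M] the mean value theorem applies, since it asks for a derivative only inside the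
  open interval and so avoids 0. Oddness carries the estimate to [-M, 0], and an interval around 0
  is split there.\<close>

lemma abs_powr_diff_le:
  fixes p a b M :: real
  assumes "1 \<le> p" "a \<le> b" "- M \<le> a" "b \<le> M"
  shows "\<bar>b\<bar> powr (p - 1) * b - \<bar>a\<bar> powr (p - 1) * a \<le> p * M powr (p - 1) * (b - a)"
proof -
  define f :: "real \<Rightarrow> real" where "f r = \<bar>r\<bar> powr (p - 1) * r" for r
  have f_nonneg: "f r = r powr p" if "0 \<le> r" for r
    using that by (cases "r = 0") (auto simp: f_def powr_diff)
  have f_minus: "f (- r) = - f r" for r
    by (simp add: f_def)
  have pos: "f d - f c \<le> p * M powr (p - 1) * (d - c)"
    if "0 \<le> c" "c \<le> d" "d \<le> M" for c d
  proof (cases "c = d")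
    case False
    then have "c < d" using that by simp
    moreover have "continuous_on {c..d} (\<lambda>r. r powr p)"
      using assms(1) that by (intro continuous_on_powr' continuous_intros) auto
    moreover have "((\<lambda>r. r powr p) has_real_derivative p * r powr (p - 1)) (at r)" if "c < r" for r
      using that \<open>0 \<le> c\<close> by (auto intro!: derivative_eq_intros has_real_derivative_powr)
    ultimately obtain l z where z: "c < z" "z < d" "((\<lambda>r. r powr p) has_real_derivative l) (at z)"
      "d powr p - c powr p = (d - c) * l"
      using MVT[of c d "\<lambda>r. r powr p"] by (metis real_differentiable_def)
    have "l = p * z powr (p - 1)"
      using z has_real_derivative_powr[of z p] that by (auto intro: DERIV_unique)
    moreover have "z powr (p - 1) \<le> M powr (p - 1)"
      using z that assms(1) by (intro powr_mono2) auto
    ultimately have "l \<le> p * M powr (p - 1)"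
      using assms(1) by simp
    then have "(d - c) * l \<le> (d - c) * (p * M powr (p - 1))"
      using \<open>c < d\<close> by (intro mult_left_mono) auto
    then show ?thesis
      using z(4) that by (simp add: f_nonneg mult.commute)
  qed simp
  have f0: "f 0 = 0"
    by (simp add: f_def)
  have "f b - f a \<le> p * M powr (p - 1) * (b - a)"
  proof -
    consider "0 \<le> a" | "b \<le> 0" | "a \<le> 0" "0 \<le> b" by linarith
    then show ?thesis
    proof cases
      case 1
      then show ?thesis using pos[of a b] assms by simp
    next
      case 2
      then show ?thesis using pos[of "- b" "- a"] assms by (simp add: f_minus)
    next
      case 3
      then show ?thesis
        using pos[of 0 b] pos[of 0 "- a"] assms by (simp add: f_minus f0 algebra_simps)
    qed
  qed
  then show ?thesis
    by (simp add: f_def)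
qed

text \<open>As 0 powr 0 = 0, the factor |r| powr (p - 1) jumps at r = 0 when p = 1. Writing the
  product as sgn r * |r| powr p keeps the exponent positive; at the limit 0 the discontinuous sign
  is harmless because it is bounded by 1.\<close>

lemma abs_powr_tendsto:
  fixes p :: real
  assumes "1 \<le> p" "(v \<longlonglongrightarrow> l)"
  shows "(\<lambda>n. \<bar>v n\<bar> powr (p - 1) * v n) \<longlonglongrightarrow> \<bar>l\<bar> powr (p - 1) * l"
proof (rule Lim_transform_eventually)
  have "(\<lambda>n. sgn (v n) * \<bar>v n\<bar> powr p) \<longlonglongrightarrow> sgn l * \<bar>l\<bar> powr p"
  proof (cases "l = 0")
    case True
    have "(\<lambda>n. \<bar>v n\<bar> powr p) \<longlonglongrightarrow> 0"
      using assms True by (intro tendsto_zero_powrI[where b = p]) (auto intro: tendsto_rabs_zero)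
    then have "(\<lambda>n. \<bar>v n\<bar> powr p * sgn (v n)) \<longlonglongrightarrow> 0"
      by (rule tendsto_0_le[where K = 1]) (auto simp: abs_mult sgn_if)
    then show ?thesis by (simp add: True mult.commute)
  next
    case False
    then show ?thesis using assms by (intro tendsto_intros) auto
  qed
  also have "sgn l * \<bar>l\<bar> powr p = \<bar>l\<bar> powr (p - 1) * l"
    by (cases "l = 0") (auto simp: powr_diff sgn_if)
  finally show "(\<lambda>n. sgn (v n) * \<bar>v n\<bar> powr p) \<longlonglongrightarrow> \<bar>l\<bar> powr (p - 1) * l" .
  show "\<forall>\<^sub>F n in sequentially. sgn (v n) * \<bar>v n\<bar> powr p = \<bar>v n\<bar> powr (p - 1) * v n"
    by (rule always_eventually, rule allI, subst powr_diff) (auto simp: sgn_if)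
qed

section \<open>Monotone iteration for an abstract system\<close>

locale monotone_system =
  fixes N :: "'a \<Rightarrow> ('a \<Rightarrow> real) \<Rightarrow> real" and h :: "'a \<Rightarrow> real" and K M :: real
  assumes N_mono: "\<And>x v w. (\<And>y. \<bar>v y\<bar> \<le> M) \<Longrightarrow> (\<And>y. \<bar>w y\<bar> \<le> M) \<Longrightarrow>
        (\<And>y. v y \<le> w y) \<Longrightarrow> N x v \<le> N x w"
    and N_bound: "\<And>x v. (\<And>y. \<bar>v y\<bar> \<le> M) \<Longrightarrow> \<bar>N x v\<bar> \<le> K * M"
    and N_tendsto: "\<And>x v w. (\<And>y. (\<lambda>n. v n y) \<longlonglongrightarrow> w y) \<Longrightarrow> (\<lambda>n. N x (v n)) \<longlonglongrightarrow> N x w"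
    and h_bound: "\<And>x. \<bar>h x\<bar> \<le> M"
begin

definition integrand :: "('a \<Rightarrow> real \<Rightarrow> real) \<Rightarrow> 'a \<Rightarrow> real \<Rightarrow> real" where
  "integrand w x s = exp (K * s) * N x (\<lambda>y. w y s)"

text \<open>Variation of constants for u' + K u = N u with initial value h; \<open>integrand\<close>
  carries the integrating factor.\<close>

definition duhamel :: "('a \<Rightarrow> real \<Rightarrow> real) \<Rightarrow> 'a \<Rightarrow> real \<Rightarrow> real" where
  "duhamel w x t = exp (- K * t) * (h x + integral {0..t} (integrand w x))"

definition admissible :: "('a \<Rightarrow> real \<Rightarrow> real) \<Rightarrow> bool" where
  "admissible w \<longleftrightarrow> (\<forall>x. continuous_on {0..} (w x) \<and> (\<forall>t\<ge>0. \<bar>w x t\<bar> \<le> M))"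

text \<open>\<open>N_tendsto\<close> is continuity along sequences that converge pointwise in y;
  applied to w at a convergent sequence of times it becomes continuity in time.\<close>

lemma continuous_on_integrand:
  assumes "\<And>x. continuous_on {0..} (w x)"
  shows "continuous_on {0..} (integrand w x)"
  unfolding integrand_def
proof (intro continuous_intros)
  show "continuous_on {0..} (\<lambda>s. N x (\<lambda>y. w y s))"
    unfolding continuous_on_sequentially o_def
    using assms by (auto intro!: N_tendsto simp: continuous_on_sequentially o_def)
qed

lemma integrand_integrable:
  assumes "\<And>x. continuous_on {0..} (w x)"
  shows "integrand w x integrable_on {0..b}"
  by (rule integrable_continuous_interval, rule continuous_on_subset[OF continuous_on_integrand])
    (use assms in auto)

lemma integrand_bound:
  assumes "\<And>y. \<bar>w y s\<bar> \<le> M"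
  shows "\<bar>integrand w x s\<bar> \<le> K * M * exp (K * s)"
  using N_bound[of "\<lambda>y. w y s" x] assms
  by (simp add: integrand_def abs_mult mult.commute mult_left_mono)

lemma has_integral_bound:
  assumes "0 \<le> t"
  shows "((\<lambda>s. K * M * exp (K * s)) has_integral M * (exp (K * t) - 1)) {0..t}"
proof -
  have "((\<lambda>s. K * M * exp (K * s)) has_integral M * exp (K * t) - M * exp (K * 0)) {0..t}"
    using assms
    by (intro fundamental_theorem_of_calculus)
      (auto intro!: derivative_eq_intros simp: has_real_derivative_iff_has_vector_derivative[symmetric])
  then show ?thesis by (simp add: algebra_simps)
qed

text \<open>Integrability is assumed in place of continuity of w so that the lemma applies to the
  limit of the iterates before that limit is known to be continuous.\<close>

lemma continuous_on_duhamel: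
  assumes "\<And>b. integrand w x integrable_on {0..b}"
  shows "continuous_on {0..} (duhamel w x)"
  unfolding duhamel_def
  by (intro continuous_intros continuous_on_atLeast indefinite_integral_continuous_1 assms)

text \<open>The initial value contributes at most M and the integral at most M (exp (K t) - 1); the
  prefactor exp (-K t) turns their sum M exp (K t) back into M.\<close>

lemma duhamel_bound:
  assumes "integrand w x integrable_on {0..t}" "\<And>y s. 0 \<le> s \<Longrightarrow> \<bar>w y s\<bar> \<le> M" "0 \<le> t"
  shows "\<bar>duhamel w x t\<bar> \<le> M"
proof -
  have "norm (integral {0..t} (integrand w x)) \<le> integral {0..t} (\<lambda>s. K * M * exp (K * s))"
    using has_integral_bound[OF assms(3)] assms(1,2)
    by (intro integral_norm_bound_integral) (auto intro: integrand_bound)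
  also have "\<dots> = M * (exp (K * t) - 1)"
    using has_integral_bound[OF assms(3)] by (rule integral_unique)
  finally have "\<bar>h x + integral {0..t} (integrand w x)\<bar> \<le> M * exp (K * t)"
    using h_bound[of x] by (simp add: algebra_simps)
  then have "exp (- K * t) * \<bar>h x + integral {0..t} (integrand w x)\<bar> \<le> exp (- K * t) * (M * exp (K * t))"
    by (rule mult_left_mono) simp
  then show ?thesis
    by (simp add: duhamel_def abs_mult exp_minus field_simps)
qed

lemma admissible_duhamel: "admissible w \<Longrightarrow> admissible (duhamel w)"
  unfolding admissible_def
  by (auto intro!: continuous_on_duhamel duhamel_bound integrand_integrable)

lemma duhamel_mono:
  assumes "admissible v" "admissible w" "\<And>y s. 0 \<le> s \<Longrightarrow> v y s \<le> w y s"
  shows "duhamel v x t \<le> duhamel w x t"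
proof -
  have "integral {0..t} (integrand v x) \<le> integral {0..t} (integrand w x)"
    using assms
    by (intro integral_le integrand_integrable)
      (auto simp: admissible_def integrand_def intro!: mult_left_mono N_mono)
  then show ?thesis by (simp add: duhamel_def)
qed

primrec iterate :: "nat \<Rightarrow> 'a \<Rightarrow> real \<Rightarrow> real" where
  "iterate 0 = (\<lambda>x t. - M)"
| "iterate (Suc n) = duhamel (iterate n)"

lemma admissible_iterate: "admissible (iterate n)"
proof (induction n)
  case 0
  then show ?case
    \<comment> \<open>The constant -M has modulus at most M only if M is nonnegative, which
      \<open>h_bound\<close> forces.\<close>
    using h_bound by (auto simp: admissible_def) (meson abs_ge_zero order_trans)
qed (simp add: admissible_duhamel)

text \<open>The start -M lies below every admissible function, in particular below its own image;
  \<open>duhamel_mono\<close> carries this first inequality through the induction.\<close>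

lemma iterate_le_Suc: "0 \<le> t \<Longrightarrow> iterate n x t \<le> iterate (Suc n) x t"
proof (induction n arbitrary: x t)
  case 0
  then show ?case
    using admissible_iterate[of "Suc 0"] by (simp add: admissible_def abs_le_iff minus_le_iff)
next
  case (Suc n)
  then show ?case
    using duhamel_mono[OF admissible_iterate[of n] admissible_iterate[of "Suc n"]] by simp
qed

lemma duhamel_fixed_point:
  obtains u where "\<And>x. continuous_on {0..} (u x)"
    "\<And>x t. 0 \<le> t \<Longrightarrow> u x t = duhamel u x t"
proof -
  define u where "u x t = lim (\<lambda>n. iterate n x t)" for x t
  have bound: "\<bar>iterate n x t\<bar> \<le> M" if "0 \<le> t" for n x t
    using admissible_iterate that by (simp add: admissible_def)
  have lim: "(\<lambda>n. iterate n x t) \<longlonglongrightarrow> u x t" if "0 \<le> t" for x t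
    unfolding u_def convergent_LIMSEQ_iff[symmetric]
    by (rule Bseq_mono_convergent[OF BseqI'[of _ M]])
      (use that bound iterate_le_Suc in \<open>auto intro: lift_Suc_mono_le\<close>)
  \<comment> \<open>The majorant K M exp (K s) is independent of n, so pointwise convergence of the
    integrands is enough.\<close>
  have dct: "integrand u x integrable_on {0..t}"
    "(\<lambda>n. integral {0..t} (integrand (iterate n) x)) \<longlonglongrightarrow> integral {0..t} (integrand u x)"
    if "0 \<le> t" for x t
  proof -
    have 1: "integrand (iterate n) x integrable_on {0..t}" for n
      using admissible_iterate by (intro integrand_integrable) (simp add: admissible_def)
    have 2: "(\<lambda>s. K * M * exp (K * s)) integrable_on {0..t}"
      using has_integral_bound[OF that] by blast
    have 3: "norm (integrand (iterate n) x s) \<le> K * M * exp (K * s)" if "s \<in> {0..t}" for n s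
      using that bound by (auto intro: integrand_bound)
    have 4: "(\<lambda>n. integrand (iterate n) x s) \<longlonglongrightarrow> integrand u x s" if "s \<in> {0..t}" for s
      unfolding integrand_def using that by (intro tendsto_intros N_tendsto lim) auto
    show "integrand u x integrable_on {0..t}"
      using dominated_convergence(1)[OF 1 2 3 4] by simp
    show "(\<lambda>n. integral {0..t} (integrand (iterate n) x)) \<longlonglongrightarrow> integral {0..t} (integrand u x)"
      using dominated_convergence(2)[OF 1 2 3 4] by simp
  qed
  have fix_eq: "u x t = duhamel u x t" if "0 \<le> t" for x t
  proof (rule LIMSEQ_unique)
    show "(\<lambda>n. iterate (Suc n) x t) \<longlonglongrightarrow> u x t"
      using lim[OF that] by (rule LIMSEQ_Suc)
    show "(\<lambda>n. iterate (Suc n) x t) \<longlonglongrightarrow> duhamel u x t"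
      unfolding iterate.simps duhamel_def by (intro tendsto_intros dct that)
  qed
  \<comment> \<open>Continuity of u is recovered from the fixed-point equation; for b < 0 the
    interval is empty.\<close>
  have "integrand u x integrable_on {0..b}" for x b
    using dct(1)[of b x] by (cases "0 \<le> b") auto
  then have "continuous_on {0..} (duhamel u x)" for x
    by (rule continuous_on_duhamel)
  then have "continuous_on {0..} (u x)" for x
    by (rule continuous_on_eq) (simp add: fix_eq[symmetric])
  then show thesis
    using that fix_eq by blast
qed

text \<open>In the product rule the exponential prefactor yields -K u, and the integral yields exp
  (-K t) times the integrand, where the exponentials cancel.\<close>

lemma duhamel_derivative:
  assumes cont: "\<And>x. continuous_on {0..} (u x)" and eq: "\<And>x t. 0 \<le> t \<Longrightarrow> u x t = duhamel u x t"
    and t: "0 \<le> t"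
  shows "(u x has_real_derivative N x (\<lambda>y. u y t) - K * u x t) (at t within {0..})"
proof -
  \<comment> \<open>The fundamental theorem of calculus is applied on a compact interval that agrees
    with the half-line near t.\<close>
  have nhd: "at t within {0..} = at t within {0..t + 1}"
    by (rule at_within_nhd[of t "{..<t + 1}"]) auto
  have "((\<lambda>r. integral {0..r} (integrand u x)) has_real_derivative integrand u x t) (at t within {0..})"
    unfolding nhd using t
    by (intro integral_has_real_derivative continuous_on_subset[OF continuous_on_integrand[OF cont]]) auto
  then have "(duhamel u x has_real_derivative
      exp (- K * t) * integrand u x t - K * duhamel u x t) (at t within {0..})"
    unfolding duhamel_def by (auto intro!: derivative_eq_intros simp: algebra_simps)
  also have "exp (- K * t) * integrand u x t = N x (\<lambda>y. u y t)"
    by (simp add: integrand_def exp_minus)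
  also have "duhamel u x t = u x t"
    using eq[OF t] by simp
  finally show ?thesis
    by (rule has_field_derivative_transform_within[where d = 1]) (use t in \<open>auto simp: eq[symmetric]\<close>)
qed

end

section \<open>Square-summable data and the reduction of the graph problem\<close>

lemma L2_bounded:
  assumes "in_L2 \<mu> A h" "0 < m" "\<And>x. x \<in> A \<Longrightarrow> m \<le> \<mu> x"
  obtains M where "0 < M" "\<And>x. x \<in> A \<Longrightarrow> \<bar>h x\<bar> \<le> M"
proof -
  define S where "S = (\<Sum>\<^sub>\<infinity>x\<in>A. \<mu> x * \<bar>h x\<bar>\<^sup>2)"
  have nonneg: "0 \<le> \<mu> x * \<bar>h x\<bar>\<^sup>2" if "x \<in> A" for x
    using assms(2) assms(3)[OF that] by simp
  have "\<bar>h x\<bar> \<le> sqrt (S / m)" if "x \<in> A" for x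
  proof (rule real_le_rsqrt)
    have "m * \<bar>h x\<bar>\<^sup>2 \<le> \<mu> x * \<bar>h x\<bar>\<^sup>2"
      using assms(3)[OF that] by (rule mult_right_mono) simp
    also have "\<dots> = (\<Sum>y\<in>{x}. \<mu> y * \<bar>h y\<bar>\<^sup>2)" by simp
    also have "\<dots> \<le> S"
      unfolding S_def using assms(1) that nonneg
      by (intro finite_sum_le_infsum) (auto simp: in_L2_def)
    finally show "\<bar>h x\<bar>\<^sup>2 \<le> S / m"
      using assms(2) by (simp add: field_simps)
  qed
  then show thesis
    \<comment> \<open>The summand 1 makes the bound strictly positive even when h vanishes.\<close>
    by (intro that[of "\<bar>sqrt (S / m)\<bar> + 1"]) fastforce+
qed

text \<open>\<open>vector_derivative\<close> is a choice operator, so its value is determined only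
  where derivatives are unique; hence the filter within \<open>{0..}\<close> must be nontrivial,
  also at t = 0.\<close>

lemma time_deriv_eq:
  assumes "(u x has_real_derivative d) (at t within {0..})" "0 \<le> t"
  shows "time_deriv u x t = d"
  unfolding time_deriv_def
proof (rule vector_derivative_within)
  have "at t within {0..t + 1} \<noteq> bot"
    using assms(2) by (simp add: trivial_limit_within islimpt_Icc)
  moreover have "at t within {0..} = at t within {0..t + 1}"
    by (rule at_within_nhd[of t "{..<t + 1}"]) auto
  ultimately show "at t within {0..} \<noteq> bot" by simp
  show "(u x has_vector_derivative d) (at t within {0..})"
    using assms(1) by (simp add: has_real_derivative_iff_has_vector_derivative)
qed

theorem theorem1p2:
  fixes V :: "'a set" and E :: "('a \<times> 'a) set"
    and \<mu> :: "'a \<Rightarrow> real" and \<omega> :: "'a \<Rightarrow> 'a \<Rightarrow> real"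
    and \<Omega> :: "'a set" and h :: "'a \<Rightarrow> real" and p :: real
  assumes "weighted_graph V E \<mu> \<omega>"
    and "(INF x\<in>V. ereal (\<mu> x)) > 0"
    and "(SUP x\<in>V. ereal (real (deg E x))) < \<infinity>"
    and "(SUP x\<in>V. ereal ((1 / \<mu> x) * (\<Sum>y \<in> E `` {x}. \<omega> x y))) < \<infinity>"
    and "\<Omega> \<subseteq> V"
    and "\<not> graph_bounded E \<Omega>"
    and "vertex_interior V E \<Omega> \<noteq> {}"
    and "in_L2 \<mu> (vertex_interior V E \<Omega>) h"
    and "p \<ge> 1"
  shows "\<exists>u :: 'a \<Rightarrow> real \<Rightarrow> real. is_solution V E \<mu> \<omega> \<Omega> p h u"
proof -
  interpret weighted_graph V E \<mu> \<omega> by fact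
  define A where "A = vertex_interior V E \<Omega>"
  have AV: "A \<subseteq> V"
    using assms(5) by (auto simp: A_def vertex_interior_def)
  define D where "D x = (1 / \<mu> x) * (\<Sum>y \<in> E `` {x}. \<omega> x y)" for x
  obtain m where "0 < ereal m" and m': "ereal m < (INF x\<in>V. ereal (\<mu> x))"
    using assms(2) ereal_dense2 by blast
  moreover have "m \<le> \<mu> x" if "x \<in> V" for x
    using less_INF_D[OF m' that] by simp
  ultimately obtain M where M: "0 < M" "\<And>x. x \<in> A \<Longrightarrow> \<bar>h x\<bar> \<le> M"
    using L2_bounded[OF assms(8), of m] AV unfolding A_def by (metis ereal_less(2) subsetD)
  obtain d where d': "(SUP x\<in>V. ereal (D x)) < ereal d"
    using assms(4) ereal_dense2 unfolding D_def by blast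
  have D_le: "D x \<le> \<bar>d\<bar>" if "x \<in> V" for x
    using SUP_lessD[OF d' that] by simp
  define f :: "real \<Rightarrow> real" where "f r = \<bar>r\<bar> powr (p - 1) * r" for r
  \<comment> \<open>|d| dominates the weighted degrees \<open>D x\<close>, and the second summand is
    the Lipschitz constant of f on [-M, M]. The absolute value keeps K nonnegative.\<close>
  define K where "K = \<bar>d\<bar> + p * M powr (p - 1)"
  \<comment> \<open>The diagonal part of the Laplacian goes into the coefficient K - D x, which
    leaves nonnegative weights on the neighbours. Zero values of N and of the initial data off A
    build in the boundary condition.\<close>
  define N where "N x v = (if x \<in> A
    then (1 / \<mu> x) * (\<Sum>y \<in> E `` {x}. \<omega> x y * v y) + ((K - D x) * v x - f (v x)) else 0)" for x v
  have K_nonneg: "0 \<le> K"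
    using assms(9) by (simp add: K_def)
  have weight_nonneg: "0 \<le> \<omega> x y" if "(x, y) \<in> E" for x y
    using edge_weight_pos[OF that] by simp
  have N_laplacian: "N x v = laplacian E \<mu> \<omega> v x - f (v x) + K * v x" if "x \<in> A" for x v
    using that
    by (simp add: N_def laplacian_def D_def algebra_simps sum_subtractf sum_distrib_left)
  have f_mono: "(K - D x) * a - f a \<le> (K - D x) * b - f b"
    if "x \<in> A" "a \<le> b" "- M \<le> a" "b \<le> M" for x a b
  proof -
    have "f b - f a \<le> p * M powr (p - 1) * (b - a)"
      unfolding f_def using that assms(9) by (intro abs_powr_diff_le)
    also have "\<dots> \<le> (K - D x) * (b - a)"
      using D_le[of x] that AV by (intro mult_right_mono) (auto simp: K_def)
    finally show ?thesis by (simp add: algebra_simps)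
  qed
  have N_mono: "N x v \<le> N x w"
    if "\<And>y. \<bar>v y\<bar> \<le> M" "\<And>y. \<bar>w y\<bar> \<le> M" "\<And>y. v y \<le> w y" for x v w
  proof (cases "x \<in> A")
    case True
    then have "0 < \<mu> x" using vertex_measure_pos AV by blast
    moreover have "(\<Sum>y \<in> E `` {x}. \<omega> x y * v y) \<le> (\<Sum>y \<in> E `` {x}. \<omega> x y * w y)"
      using that weight_nonneg by (intro sum_mono mult_left_mono) auto
    moreover have "(K - D x) * v x - f (v x) \<le> (K - D x) * w x - f (w x)"
      using that[of x] True by (intro f_mono) (auto simp: abs_le_iff minus_le_iff)
    ultimately show ?thesis
      using True by (auto simp: N_def intro!: add_mono divide_right_mono)
  qed (simp add: N_def)
  have N_const: "N x (\<lambda>_. c) = K * c - f c" if "x \<in> A" for x c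
    using that by (simp add: N_laplacian laplacian_def)
  \<comment> \<open>The Laplacian kills constants, so these signs bound N by K M at the constant M
    and from below by -K M at -M; monotonicity puts every other value in between.\<close>
  have fM: "0 \<le> f M" "f (- M) \<le> 0"
    using M(1) by (auto simp: f_def)
  interpret monotone_system N "\<lambda>x. if x \<in> A then h x else 0" K M
  proof
    fix x and v :: "'a \<Rightarrow> real" assume v: "\<And>y. \<bar>v y\<bar> \<le> M"
    show "\<bar>N x v\<bar> \<le> K * M"
    proof (cases "x \<in> A")
      case True
      have "N x v \<le> N x (\<lambda>_. M)" "N x (\<lambda>_. - M) \<le> N x v"
        using v M(1) by (auto intro!: N_mono simp: abs_le_iff minus_le_iff)
      then show ?thesis
        using fM True by (simp add: N_const abs_le_iff)
    qed (use K_nonneg M in \<open>simp add: N_def\<close>)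
  next
    fix x and v :: "nat \<Rightarrow> 'a \<Rightarrow> real" and w
    assume lim: "\<And>y. (\<lambda>n. v n y) \<longlonglongrightarrow> w y"
    show "(\<lambda>n. N x (v n)) \<longlonglongrightarrow> N x w"
      unfolding N_def f_def using assms(9) lim
      by (cases "x \<in> A") (auto intro!: tendsto_intros abs_powr_tendsto simp del: times_divide_eq_left)
  qed (use N_mono M in auto)
  obtain u where u: "\<And>x. continuous_on {0..} (u x)"
    "\<And>x t. 0 \<le> t \<Longrightarrow> u x t = duhamel u x t"
    using duhamel_fixed_point by blast
  have deriv: "(u x has_real_derivative N x (\<lambda>y. u y t) - K * u x t) (at t within {0..})"
    if "0 \<le> t" for x t
    using duhamel_derivative[OF u that] .
  have td: "time_deriv u x t = N x (\<lambda>y. u y t) - K * u x t" if "0 \<le> t" for x t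
    using time_deriv_eq[OF deriv[OF that] that] .
  have cont: "continuous_on {0..} (\<lambda>t. N x (\<lambda>y. u y t) - K * u x t)" for x
  proof -
    \<comment> \<open>Multiplying \<open>integrand\<close> by exp (-K t) gives N back, which thereby
      inherits its continuity in time.\<close>
    have "continuous_on {0..} (\<lambda>t. exp (- K * t) * integrand u x t - K * u x t)"
      by (intro continuous_intros continuous_on_integrand u(1))
    then show ?thesis by (simp add: integrand_def flip: mult.assoc exp_add)
  qed
  have "time_C1 V u"
    unfolding time_C1_def
  proof (intro ballI conjI)
    fix x
    show "u x differentiable_on {0..}"
      unfolding differentiable_on_def real_differentiable_def
      by (intro ballI exI, rule deriv) simp
    show "continuous_on {0..} (time_deriv u x)"
      using cont[of x] by (rule continuous_on_eq) (simp add: td)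
  qed
  moreover have "u x 0 = h x" if "x \<in> A" for x
    by (subst u(2)) (use that in \<open>auto simp: duhamel_def\<close>)
  moreover have "u x t = 0" if "x \<notin> A" "0 \<le> t" for x t
    by (subst u(2)) (use that in \<open>auto simp: duhamel_def integrand_def[abs_def] N_def\<close>)
  ultimately have "is_solution V E \<mu> \<omega> \<Omega> p h u"
    unfolding is_solution_def A_def[symmetric]
    by (auto simp: td N_laplacian f_def)
  then show ?thesis by blast
qed

end
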